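(* Let $q=\overrightarrow{\varepsilon}=(u_1,u_2,u_3)=u_1i+u_2j+u_3k$ be a timelike pure unit split quaternion. Then for every $\theta\in\mathbb{R}$, $$e^{\theta\mathbf{L}_q}=\cos\theta\,\mathbf{I}_4+\sin\theta\,\mathbf{L}_q\quad\text{and}\quad e^{\theta\mathbf{R}_q}=\cos\theta\,\mathbf{I}_4+\sin\theta\,\mathbf{R}_q.$$
   Context: The split quaternions $\widehat{\mathbb{H}}$ form the real associative algebra with basis $\{1,i,j,k\}$ and products $i^2=-1$, $j^2=k^2=1$, $ij=k=-ji$, $jk=-i=-kj$, $ki=j=-ik$. For $q=q_0+q_1i+q_2j+q_3k$, put $I_q=q_0^2+q_1^2-q_2^2-q_3^2$ and $N_q=\sqrt{|I_q|}$. The split quaternion $q$ is timelike if $I_q>0$, spacelike if $I_q<0$, lightlike if $I_q=0$; it is pure if $q_0=0$ and unit if $N_q=1$. Pure split quaternions $u_1i+u_2j+u_3k$ are identified with vectors $(u_1,u_2,u_3)\in\mathbb{R}^3$. Thus a timelike pure unit split quaternion is one with $-u_1^2+u_2^2+u_3^2=-1$. The left and right matrix representations of $q$ (matrices of $p\mapsto qp$ and $p\mapsto pq$ in the basis $1,i,j,k$) are $$\mathbf{L}_q=\begin{bmatrix}q_0&-q_1&q_2&q_3\\ q_1&q_0&q_3&-q_2\\ q_2&q_3&q_0&-q_1\\ q_3&-q_2&q_1&q_0\end{bmatrix},\qquad \mathbf{R}_q=\begin{bmatrix}q_0&-q_1&q_2&q_3\\ q_1&q_0&-q_3&q_2\\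 q_2&-q_3&q_0&q_1\\ q_3&q_2&-q_1&q_0\end{bmatrix}.$$ $\mathbf{I}_4$ is the $4\times4$ identity matrix and $e^{A}$ denotes the matrix exponential. *)

theory Defs
  imports "HOL-Analysis.Analysis"
begin

datatype split_quat = SQuat (sq0: real) (sq1: real) (sq2: real) (sq3: real)

lemma split_quat_eq_iff:
  "p = q \<longleftrightarrow> sq0 p = sq0 q \<and> sq1 p = sq1 q \<and> sq2 p = sq2 q \<and> sq3 p = sq3 q"
  by (cases p; cases q) simp

instantiation split_quat :: real_algebra_1
begin

definition "0 = SQuat 0 0 0 0"

definition "1 = SQuat 1 0 0 0"

definition "p + q = SQuat (sq0 p + sq0 q) (sq1 p + sq1 q) (sq2 p + sq2 q) (sq3 p + sq3 q)"

definition "- p = SQuat (- sq0 p) (- sq1 p) (- sq2 p) (- sq3 p)"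

definition "p - q = SQuat (sq0 p - sq0 q) (sq1 p - sq1 q) (sq2 p - sq2 q) (sq3 p - sq3 q)"

definition "r *\<^sub>R p = SQuat (r * sq0 p) (r * sq1 p) (r * sq2 p) (r * sq3 p)"

definition "p * q = SQuat
  (sq0 p * sq0 q - sq1 p * sq1 q + sq2 p * sq2 q + sq3 p * sq3 q)
  (sq0 p * sq1 q + sq1 p * sq0 q - sq2 p * sq3 q + sq3 p * sq2 q)
  (sq0 p * sq2 q - sq1 p * sq3 q + sq2 p * sq0 q + sq3 p * sq1 q)
  (sq0 p * sq3 q + sq1 p * sq2 q - sq2 p * sq1 q + sq3 p * sq0 q)"

instance
  by standard
    (simp_all add: split_quat_eq_iff zero_split_quat_def one_split_quat_def plus_split_quat_def
      uminus_split_quat_def minus_split_quat_def scaleR_split_quat_def times_split_quat_def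
      algebra_simps)

end

lemmas split_quat_defs = zero_split_quat_def one_split_quat_def plus_split_quat_def
  uminus_split_quat_def minus_split_quat_def scaleR_split_quat_def times_split_quat_def

definition sq_i :: split_quat where "sq_i = SQuat 0 1 0 0"

definition sq_j :: split_quat where "sq_j = SQuat 0 0 1 0"

definition sq_k :: split_quat where "sq_k = SQuat 0 0 0 1"

lemma sq_basis_products:
  "sq_i * sq_i = - 1" "sq_j * sq_j = 1" "sq_k * sq_k = 1"
  "sq_i * sq_j = sq_k" "sq_j * sq_i = - sq_k"
  "sq_j * sq_k = - sq_i" "sq_k * sq_j = sq_i"
  "sq_k * sq_i = sq_j" "sq_i * sq_k = - sq_j"
  by (simp_all add: sq_i_def sq_j_def sq_k_def split_quat_defs)

lemma sq_basis_expansion: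
  "q = sq0 q *\<^sub>R 1 + sq1 q *\<^sub>R sq_i + sq2 q *\<^sub>R sq_j + sq3 q *\<^sub>R sq_k"
  by (simp add: sq_i_def sq_j_def sq_k_def split_quat_defs)

definition sq_I :: "split_quat \<Rightarrow> real" where
  "sq_I q = (sq0 q)\<^sup>2 + (sq1 q)\<^sup>2 - (sq2 q)\<^sup>2 - (sq3 q)\<^sup>2"

definition sq_N :: "split_quat \<Rightarrow> real" where
  "sq_N q = sqrt \<bar>sq_I q\<bar>"

definition timelike :: "split_quat \<Rightarrow> bool" where
  "timelike q \<longleftrightarrow> sq_I q > 0"

definition pure_sq :: "split_quat \<Rightarrow> bool" where
  "pure_sq q \<longleftrightarrow> sq0 q = 0"

definition unit_sq :: "split_quat \<Rightarrow> bool" where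
  "unit_sq q \<longleftrightarrow> sq_N q = 1"

lemma timelike_pure_unit_iff:
  "timelike q \<and> pure_sq q \<and> unit_sq q \<longleftrightarrow>
     sq0 q = 0 \<and> - (sq1 q)\<^sup>2 + (sq2 q)\<^sup>2 + (sq3 q)\<^sup>2 = - 1"
  by (auto simp: timelike_def pure_sq_def unit_sq_def sq_N_def sq_I_def)

definition Lmat :: "split_quat \<Rightarrow> real^4^4" where
  "Lmat q = vector
    [vector [sq0 q, - sq1 q, sq2 q, sq3 q],
     vector [sq1 q, sq0 q, sq3 q, - sq2 q],
     vector [sq2 q, sq3 q, sq0 q, - sq1 q],
     vector [sq3 q, - sq2 q, sq1 q, sq0 q]]"

definition Rmat :: "split_quat \<Rightarrow> real^4^4" where
  "Rmat q = vector
    [vector [sq0 q, - sq1 q, sq2 q, sq3 q],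
     vector [sq1 q, sq0 q, - sq3 q, sq2 q],
     vector [sq2 q, - sq3 q, sq0 q, sq1 q],
     vector [sq3 q, sq2 q, - sq1 q, sq0 q]]"

definition sq_coords :: "split_quat \<Rightarrow> real^4" where
  "sq_coords q = vector [sq0 q, sq1 q, sq2 q, sq3 q]"

lemma vector_4_nth [simp]:
  "(vector [a, b, c, d] :: ('a::zero)^4) $ 1 = a"
  "(vector [a, b, c, d] :: ('a::zero)^4) $ 2 = b"
  "(vector [a, b, c, d] :: ('a::zero)^4) $ 3 = c"
  "(vector [a, b, c, d] :: ('a::zero)^4) $ 4 = d"
  unfolding vector_def by simp_all

lemma Lmat_mult_coords: "Lmat q *v sq_coords p = sq_coords (q * p)"
  by (simp add: vec_eq_iff forall_4 matrix_vector_mult_def sum_4 Lmat_def sq_coords_def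
      times_split_quat_def)

lemma Rmat_mult_coords: "Rmat q *v sq_coords p = sq_coords (p * q)"
  by (simp add: vec_eq_iff forall_4 matrix_vector_mult_def sum_4 Rmat_def sq_coords_def
      times_split_quat_def algebra_simps)

(* Pitfall: on the type real^'n^'n the overloaded operations *, ^ and 1 act entrywise, so powers
   with respect to the matrix product ** need their own definition. *)
primrec matpow :: "real^'n^'n \<Rightarrow> nat \<Rightarrow> real^'n^'n" where
  "matpow A 0 = mat 1"
| "matpow A (Suc n) = A ** matpow A n"

definition mat_exp :: "real^'n^'n \<Rightarrow> real^'n^'n" where
  "mat_exp A = (\<Sum>n. matpow A n /\<^sub>R fact n)"

lemma summable_mat_exp:
  fixes A :: "real^'n^'n"
  shows "summable (\<lambda>n. matpow A n /\<^sub>R fact n)"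
proof -
  have "bounded_bilinear ((**) :: real^'n^'n \<Rightarrow> real^'n^'n \<Rightarrow> real^'n^'n)"
    by (subst bilinear_conv_bounded_bilinear [symmetric])
      (auto simp: bilinear_def linear_iff matrix_matrix_mult_def vec_eq_iff sum.distrib
        sum_distrib_left algebra_simps)
  from bounded_bilinear.pos_bounded [OF this] obtain K where K: "K > 0"
    and le: "\<And>(A :: real^'n^'n) (B :: real^'n^'n). norm (A ** B) \<le> norm A * norm B * K"
    by blast
  let ?c = "norm (mat 1 :: real^'n^'n)"
  have bound: "norm (matpow A n) \<le> (norm A * K) ^ n * ?c" for n
  proof (induction n)
    case (Suc n)
    have "norm (matpow A (Suc n)) \<le> (norm A * K) * norm (matpow A n)"
      using le [of A "matpow A n"] by (simp add: mult_ac)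
    also have "\<dots> \<le> (norm A * K) * ((norm A * K) ^ n * ?c)"
      using Suc K by (intro mult_left_mono) auto
    finally show ?case by (simp add: mult_ac)
  qed simp
  have "summable (\<lambda>n. inverse (fact n) * (norm A * K) ^ n * ?c)"
    by (intro summable_mult2 summable_exp)
  then show ?thesis
  proof (rule summable_comparison_test')
    show "norm (matpow A n /\<^sub>R fact n) \<le> inverse (fact n) * (norm A * K) ^ n * ?c" for n
      using mult_left_mono [OF bound [of n], of "inverse (fact n)"] by (simp add: mult_ac)
  qed
qed

lemma mat_exp_sums: "(\<lambda>n. matpow A n /\<^sub>R fact n) sums mat_exp A"
  unfolding mat_exp_def by (rule summable_sums [OF summable_mat_exp])

end

theory Submission
  imports Defs
begin

text \<open>
  Both identities are instances of Euler's formula: any square matrix \<open>A\<close> with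
  \<open>A ** A = - mat 1\<close> is a complex structure, so its powers behave like those of the imaginary
  unit and the exponential series of \<open>\<theta> *\<^sub>R A\<close> splits into the cosine series (times the identity)
  and the sine series (times \<open>A\<close>); see \<open>mat_exp_complex_structure\<close>.

  That \<open>Lmat q\<close> and \<open>Rmat q\<close> are complex structures comes from the algebra itself. A timelike pure
  unit \<open>q\<close> satisfies \<open>q * q = - 1\<close>; left multiplication is a representation of the split
  quaternions and right multiplication an anti-representation, so both turn this equation into
  the corresponding matrix equation.
\<close>

text \<open>
  The Taylor coefficients of cosine and sine satisfy \<open>c\<^sub>n\<^sub>+\<^sub>1 = - s\<^sub>n / (n + 1)\<close> and
  \<open>s\<^sub>n\<^sub>+\<^sub>1 = c\<^sub>n / (n + 1)\<close>. Multiplication by \<open>A\<close> exchanges the coordinates of \<open>mat 1\<close> and \<open>A\<close> in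
  exactly this way, which gives an induction without a parity distinction.
\<close>
lemma exp_series_term_complex_structure:
  fixes A :: "real^'n^'n"
  assumes "A ** A = - mat 1"
  shows "matpow (\<theta> *\<^sub>R A) n /\<^sub>R fact n
    = (cos_coeff n *\<^sub>R \<theta> ^ n) *\<^sub>R mat 1 + (sin_coeff n *\<^sub>R \<theta> ^ n) *\<^sub>R A"
proof (induction n)
  case 0
  show ?case by simp
next
  case (Suc n)
  have "matpow (\<theta> *\<^sub>R A) (Suc n) /\<^sub>R fact (Suc n)
      = (\<theta> / real (Suc n)) *\<^sub>R (A ** (matpow (\<theta> *\<^sub>R A) n /\<^sub>R fact n))"
    by (simp add: matrix_scalar_ac scalar_matrix_assoc [symmetric] field_simps)
  also have "\<dots> = (\<theta> / real (Suc n)) *\<^sub>R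
      ((cos_coeff n * \<theta> ^ n) *\<^sub>R A - (sin_coeff n * \<theta> ^ n) *\<^sub>R mat 1)"
    unfolding Suc.IH
    by (simp add: matrix_add_ldistrib matrix_scalar_ac scalar_matrix_assoc [symmetric] assms)
  also have "\<dots> = (cos_coeff (Suc n) *\<^sub>R \<theta> ^ Suc n) *\<^sub>R mat 1
      + (sin_coeff (Suc n) *\<^sub>R \<theta> ^ Suc n) *\<^sub>R A"
    by (simp add: cos_coeff_Suc sin_coeff_Suc scaleR_diff_right mult_ac)
  finally show ?case .
qed

lemma mat_exp_complex_structure:
  fixes A :: "real^'n^'n"
  assumes "A ** A = - mat 1"
  shows "mat_exp (\<theta> *\<^sub>R A) = cos \<theta> *\<^sub>R mat 1 + sin \<theta> *\<^sub>R A"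
proof -
  have "(\<lambda>n. matpow (\<theta> *\<^sub>R A) n /\<^sub>R fact n) sums (cos \<theta> *\<^sub>R mat 1 + sin \<theta> *\<^sub>R A)"
    unfolding exp_series_term_complex_structure [OF assms]
    by (intro sums_add sums_scaleR_left cos_converges sin_converges)
  with mat_exp_sums show ?thesis by (rule sums_unique2)
qed

lemma Lmat_mult: "Lmat p ** Lmat q = Lmat (p * q)"
  by (simp add: vec_eq_iff forall_4 matrix_matrix_mult_def sum_4 Lmat_def times_split_quat_def
      algebra_simps)

text \<open>The factors are reversed because \<open>Rmat q\<close> acts first and thus multiplies first from the right.\<close>
lemma Rmat_mult: "Rmat p ** Rmat q = Rmat (q * p)"
  by (simp add: vec_eq_iff forall_4 matrix_matrix_mult_def sum_4 Rmat_def times_split_quat_def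
      algebra_simps)

lemma Lmat_minus_one: "Lmat (- 1) = - mat 1"
  by (simp add: vec_eq_iff forall_4 Lmat_def mat_def one_split_quat_def uminus_split_quat_def)

lemma Rmat_minus_one: "Rmat (- 1) = - mat 1"
  by (simp add: vec_eq_iff forall_4 Rmat_def mat_def one_split_quat_def uminus_split_quat_def)

text \<open>
  The mixed products of \<open>i\<close>, \<open>j\<close>, \<open>k\<close> anticommute and cancel in the square of a pure element, so
  only the scalar part \<open>- sq_I q\<close> survives.
\<close>
lemma pure_square: "pure_sq q \<Longrightarrow> q * q = - sq_I q *\<^sub>R 1"
  by (simp add: pure_sq_def sq_I_def split_quat_defs power2_eq_square)

lemma timelike_pure_unit_square:
  assumes "timelike q" "pure_sq q" "unit_sq q"
  shows "q * q = - 1"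
proof -
  have "sq_I q = 1"
    using assms by (simp add: timelike_def unit_sq_def sq_N_def)
  then show ?thesis
    using pure_square [OF \<open>pure_sq q\<close>] by simp
qed

theorem theorem6:
  fixes q :: split_quat and u1 u2 u3 \<theta> :: real
  assumes "q = u1 *\<^sub>R sq_i + u2 *\<^sub>R sq_j + u3 *\<^sub>R sq_k"
    and "timelike q" and "pure_sq q" and "unit_sq q"
  shows "mat_exp (\<theta> *\<^sub>R Lmat q) = cos \<theta> *\<^sub>R mat 1 + sin \<theta> *\<^sub>R Lmat q
    \<and> mat_exp (\<theta> *\<^sub>R Rmat q) = cos \<theta> *\<^sub>R mat 1 + sin \<theta> *\<^sub>R Rmat q"
proof -
  have "q * q = - 1"
    using assms(2-4) by (rule timelike_pure_unit_square)
  then have "Lmat q ** Lmat q = - mat 1" "Rmat q ** Rmat q = - mat 1"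
    by (simp_all add: Lmat_mult Rmat_mult Lmat_minus_one Rmat_minus_one)
  then show ?thesis
    by (simp add: mat_exp_complex_structure)
qed

end
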